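(* Let $\beta>0$ and let $N_t$ be the self-exciting point process with intensity $\lambda_t=\beta+\frac{N_{t-}}{t+1}$. For any $t>s\ge 0$, $$\mathrm{Cov}[N_t,N_s]=-\beta(t+1)\log(s+1)+2\beta s(t+1).$$
   Context: $N_t$ is a simple point process on $(0,\infty)$ with $N_0=0$ (empty past history) whose intensity at time $t$ with respect to its natural filtration is $\lambda_t=\lambda\left(\frac{N_{t-}}{t+1}\right)$ with $\lambda(z)=\beta+z$. *)

theory Defs
  imports "HOL-Probability.Probability"
begin

text \<open>
  A simple point process on \<open>(0,\<infinity>)\<close> is represented by its random set of points
  \<open>P \<omega>\<close>, which is locally finite; multiplicities are excluded by working with a set.
\<close>

definition count_upto :: "('a \<Rightarrow> real set) \<Rightarrow> real \<Rightarrow> 'a \<Rightarrow> nat" where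
  "count_upto P t \<omega> = card (P \<omega> \<inter> {0<..t})"

text \<open>The left limit at \<open>t\<close> of the counting process.\<close>

definition count_before :: "('a \<Rightarrow> real set) \<Rightarrow> real \<Rightarrow> 'a \<Rightarrow> nat" where
  "count_before P t \<omega> = card (P \<omega> \<inter> {0<..<t})"

definition simple_point_process :: "'a measure \<Rightarrow> ('a \<Rightarrow> real set) \<Rightarrow> bool" where
  "simple_point_process M P \<longleftrightarrow>
     (\<forall>\<omega>\<in>space M. P \<omega> \<subseteq> {0<..} \<and> (\<forall>t. finite (P \<omega> \<inter> {0<..t}))) \<and>
     (\<forall>t. count_upto P t \<in> measurable M (count_space UNIV))"

text \<open>
  Since \<open>N\<^sub>0 = 0\<close>, the counts \<open>N\<^sub>u\<close>, \<open>0 \<le> u \<le> t\<close>, generate the same sigma-algebra as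
  the counts \<open>N(C)\<close> of all Borel sets \<open>C \<subseteq> (0,t]\<close>. No null sets are added.
\<close>

definition natural_filtration :: "'a measure \<Rightarrow> ('a \<Rightarrow> real set) \<Rightarrow> real \<Rightarrow> 'a measure" where
  "natural_filtration M P t =
     sigma (space M) {count_upto P u -` B \<inter> space M | u B. 0 \<le> u \<and> u \<le> t}"

definition progressively_measurable :: "(real \<Rightarrow> 'a measure) \<Rightarrow> (real \<Rightarrow> 'a \<Rightarrow> real) \<Rightarrow> bool" where
  "progressively_measurable F X \<longleftrightarrow>
     (\<forall>t\<ge>0. (\<lambda>(u, \<omega>). X u \<omega>) \<in> borel_measurable (restrict_space borel {0..t} \<Otimes>\<^sub>M F t))"

definition predictable :: "'a measure \<Rightarrow> (real \<Rightarrow> 'a measure) \<Rightarrow> (real \<times> 'a) measure" where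
  "predictable M F =
     sigma ({0<..} \<times> space M) {{a<..b} \<times> A | a b A. 0 \<le> a \<and> a \<le> b \<and> A \<in> sets (F a)}"

text \<open>
  Stochastic intensity in the sense of Bremaud: besides the regularity conditions,
  \<open>E \<integral> C dN = E \<integral> C\<^sub>u \<lambda>\<^sub>u du\<close> for every nonnegative \<open>F\<close>-predictable \<open>C\<close>, where
  \<open>\<integral> C dN\<close> is the sum of \<open>C\<^sub>u\<close> over the points \<open>u\<close> of the process. Both sides are
  extended nonnegative reals, so no moment assumption is built in.

  Testing only with indicators of predictable rectangles, that is, requiring
  \<open>E[N\<^sub>b - N\<^sub>a | F\<^sub>a] = E[\<integral>\<^sub>a\<^sup>b \<lambda>\<^sub>u du | F\<^sub>a]\<close>, would not suffice here: without integrability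
  of \<open>N\<close> both sides may be infinite.
\<close>

definition stochastic_intensity ::
  "'a measure \<Rightarrow> ('a \<Rightarrow> real set) \<Rightarrow> (real \<Rightarrow> 'a measure) \<Rightarrow> (real \<Rightarrow> 'a \<Rightarrow> real) \<Rightarrow> bool" where
  "stochastic_intensity M P F lam \<longleftrightarrow>
     filtration (space M) F \<and>
     (\<forall>t. subalgebra M (F t)) \<and>
     (\<forall>t. count_upto P t \<in> measurable (F t) (count_space UNIV)) \<and>
     progressively_measurable F lam \<and>
     (\<forall>u>0. \<forall>\<omega>\<in>space M. 0 \<le> lam u \<omega>) \<and>
     (\<forall>t\<ge>0. AE \<omega> in M. (\<integral>\<^sup>+u\<in>{0<..t}. ennreal (lam u \<omega>) \<partial>lborel) < \<infinity>) \<and>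
     (\<forall>C \<in> borel_measurable (predictable M F).
        (\<integral>\<^sup>+\<omega>. (\<integral>\<^sup>+u. C (u, \<omega>) \<partial>count_space (P \<omega>)) \<partial>M) =
        (\<integral>\<^sup>+\<omega>. (\<integral>\<^sup>+u\<in>{0<..}. C (u, \<omega>) * ennreal (lam u \<omega>) \<partial>lborel) \<partial>M))"

definition covariance :: "'a measure \<Rightarrow> ('a \<Rightarrow> real) \<Rightarrow> ('a \<Rightarrow> real) \<Rightarrow> real" where
  "covariance M X Y =
     (\<integral>\<omega>. (X \<omega> - (\<integral>\<omega>'. X \<omega>' \<partial>M)) * (Y \<omega> - (\<integral>\<omega>'. Y \<omega>' \<partial>M)) \<partial>M)"

end

theory Submission
  imports Defs
begin

text \<open>
  Testing the intensity against the predictable process \<open>1\<^bsub>s < u \<le> t\<^esub> g(N\<^sub>s) h(N\<^bsub>u-\<^esub>)\<close> and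
  telescoping over the points gives
  \<open>E g(N\<^sub>s) (h(N\<^sub>s) + \<dots> + h(N\<^sub>t - 1)) = \<integral>\<^sub>s\<^sup>t E g(N\<^sub>s) h(N\<^sub>u) (\<beta> + N\<^sub>u / (u + 1)) du\<close>.
  With a truncated \<open>h(k) = 2k + 1\<close> and Gronwall's inequality, the second moments are finite.
  The choices \<open>g = h = 1\<close>; \<open>g = 1\<close>, \<open>h(k) = 2k + 1\<close>; and \<open>g(k) = k\<close>, \<open>h = 1\<close> then give linear
  integral equations for \<open>E N\<^sub>t\<close>, \<open>E N\<^sub>t\<^sup>2\<close> and \<open>E N\<^sub>s N\<^sub>t\<close>, whose bounded solutions are unique.
\<close>

section \<open>Counting functions of a locally finite set\<close>

text \<open>Counts are tested on the events \<open>k \<le> f x\<close> because, unlike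
  \<open>f x = k\<close>, these have direct descriptions by countably many set operations in the
  next two characterizations.\<close>

lemma measurable_nat_geI:
  fixes f :: "'b \<Rightarrow> nat"
  assumes "\<And>k. {x \<in> space N. k \<le> f x} \<in> sets N"
  shows "f \<in> measurable N (count_space UNIV)"
proof (subst measurable_count_space_eq2_countable, intro conjI ballI)
  fix k :: nat
  have "f -` {k} \<inter> space N = {x \<in> space N. k \<le> f x} - {x \<in> space N. Suc k \<le> f x}"
    by auto
  then show "f -` {k} \<inter> space N \<in> sets N"
    using assms by (metis sets.Diff)
qed auto

text \<open>The last point before \<open>u\<close> lies strictly below \<open>u\<close>, so a
  rational fits in between. The left limit is thereby determined by countably many times strictly
  before \<open>u\<close>, which is the source of its predictability. For \<open>k = 0\<close> and
  \<open>u \<le> 0\<close> the right side would have no witness.\<close>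

lemma count_before_ge_iff:
  assumes "\<And>t. finite (P \<omega> \<inter> {0<..t})" and "k > 0"
  shows "k \<le> count_before P u \<omega> \<longleftrightarrow> (\<exists>q\<in>\<rat> \<inter> {0..}. q < u \<and> k \<le> count_upto P q \<omega>)"
proof
  let ?A = "P \<omega> \<inter> {0<..<u}"
  have fin: "finite ?A"
    by (rule finite_subset[OF _ assms(1)[of u]]) auto
  assume k: "k \<le> count_before P u \<omega>"
  then have "?A \<noteq> {}"
    using \<open>k > 0\<close> by (auto simp: count_before_def)
  then have Max: "Max ?A \<in> ?A"
    using fin by (rule Max_in[rotated])
  then obtain q where q: "q \<in> \<rat>" "Max ?A < q" "q < u"
    using Rats_dense_in_real[of "Max ?A" u] by auto
  have "?A \<subseteq> P \<omega> \<inter> {0<..q}"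
    using Max_ge[OF fin] q by force
  then have "k \<le> count_upto P q \<omega>"
    using k card_mono[OF assms(1)] unfolding count_before_def count_upto_def by (meson le_trans)
  then show "\<exists>q\<in>\<rat> \<inter> {0..}. q < u \<and> k \<le> count_upto P q \<omega>"
    using q Max by (intro bexI[of _ q]) auto
next
  assume "\<exists>q\<in>\<rat> \<inter> {0..}. q < u \<and> k \<le> count_upto P q \<omega>"
  then obtain q where "q < u" "k \<le> count_upto P q \<omega>"
    by auto
  moreover have "finite (P \<omega> \<inter> {0<..<u})"
    by (rule finite_subset[OF _ assms(1)[of u]]) auto
  ultimately show "k \<le> count_before P u \<omega>"
    unfolding count_before_def count_upto_def
    by (elim order.trans) (auto intro!: card_mono)
qed

text \<open>Right continuity: by local finiteness there are no points in some interval just after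
  \<open>u\<close>, so the strict count slightly to the right of \<open>u\<close> agrees with the
  count up to \<open>u\<close>. This transfers joint measurability from \<open>count_before\<close>
  to \<open>count_upto\<close>.\<close>

lemma count_upto_ge_iff:
  assumes "\<And>t. finite (P \<omega> \<inter> {0<..t})"
  shows "k \<le> count_upto P u \<omega> \<longleftrightarrow> (\<forall>n. k \<le> count_before P (u + 1 / real (Suc n)) \<omega>)"
proof
  assume "k \<le> count_upto P u \<omega>"
  moreover have "count_upto P u \<omega> \<le> count_before P (u + 1 / real (Suc n)) \<omega>" for n
    unfolding count_before_def count_upto_def
  proof (intro card_mono finite_subset[OF _ assms(1)[of "u + 1 / real (Suc n)"]])
    have "u < u + 1 / real (Suc n)"
      by simp
    then have "x < u + 1 / real (Suc n)" if "x \<le> u" for x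
      using that by linarith
    then show "P \<omega> \<inter> {0<..u} \<subseteq> P \<omega> \<inter> {0<..<u + 1 / real (Suc n)}"
      by (auto simp del: of_nat_Suc)
  qed auto
  ultimately show "\<forall>n. k \<le> count_before P (u + 1 / real (Suc n)) \<omega>"
    using order.trans by blast
next
  assume *: "\<forall>n. k \<le> count_before P (u + 1 / real (Suc n)) \<omega>"
  let ?B = "P \<omega> \<inter> {0<..u + 1} \<inter> {u<..}"
  have fin: "finite ?B"
    using assms by auto
  \<comment> \<open>The witness is the distance from \<open>u\<close> to the next point within
    \<open>(u, u + 1]\<close>. If there is no such point, any positive number works and 1 is
    taken.\<close>
  have "\<exists>d>0. \<forall>x\<in>?B. d \<le> x - u"
  proof (cases "?B = {}")
    case False
    then show ?thesis
      using fin Min_in[OF fin False] Min_le[OF fin]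
      by (intro exI[of _ "Min ?B - u"]) auto
  qed (auto intro: exI[of _ 1])
  then obtain d where d: "d > 0" "\<forall>x\<in>?B. d \<le> x - u"
    by auto
  obtain n where n: "1 / real (Suc n) < d"
    using \<open>d > 0\<close> nat_approx_posE by blast
  have "1 / real (Suc n) \<le> 1"
    by simp
  have "P \<omega> \<inter> {0<..<u + 1 / real (Suc n)} \<subseteq> P \<omega> \<inter> {0<..u}"
  proof
    fix x assume x: "x \<in> P \<omega> \<inter> {0<..<u + 1 / real (Suc n)}"
    have "x \<le> u"
    proof (rule ccontr)
      assume "\<not> x \<le> u"
      moreover have "x \<le> u + 1"
        using x \<open>1 / real (Suc n) \<le> 1\<close> unfolding Int_iff greaterThanLessThan_iff by linarith
      ultimately have "x \<in> ?B"
        using x by auto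
      then have "d \<le> x - u"
        using d by blast
      then show False
        using x n by auto
    qed
    then show "x \<in> P \<omega> \<inter> {0<..u}"
      using x by auto
  qed
  then have "count_before P (u + 1 / real (Suc n)) \<omega> \<le> count_upto P u \<omega>"
    unfolding count_before_def count_upto_def using assms by (intro card_mono) auto
  then show "k \<le> count_upto P u \<omega>"
    using * order.trans by blast
qed

lemma count_upto_mono:
  assumes "\<And>t. finite (P \<omega> \<inter> {0<..t})" and "s \<le> t"
  shows "count_upto P s \<omega> \<le> count_upto P t \<omega>"
  unfolding count_upto_def using assms by (intro card_mono) auto

text \<open>The two counts differ only at points of the process, and a locally finite set is
  countable, hence null. Inside time integrals the left limit may therefore be replaced by the count
  itself.\<close>

lemma AE_count_before_eq_count_upto:
  assumes "\<And>t. finite (P \<omega> \<inter> {0<..t})"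
  shows "AE u in lborel. count_before P u \<omega> = count_upto P u \<omega>"
proof -
  have "P \<omega> \<inter> {0<..} = (\<Union>n::nat. P \<omega> \<inter> {0<..real n})"
    using real_arch_simple by auto
  moreover have "countable (\<Union>n::nat. P \<omega> \<inter> {0<..real n})"
    using assms by (intro countable_UN[OF countableI_type] countable_finite)
  ultimately have "P \<omega> \<inter> {0<..} \<in> null_sets lborel"
    using countable_imp_null_set_lborel by metis
  then have "AE u in lborel. u \<notin> P \<omega> \<inter> {0<..}"
    by (rule AE_not_in)
  then show ?thesis
  proof eventually_elim
    case (elim u)
    have "P \<omega> \<inter> {0<..<u} = P \<omega> \<inter> {0<..u}"
      using elim by (auto simp: order.strict_iff_order)
    then show ?case
      by (simp add: count_before_def count_upto_def)
  qed
qed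

text \<open>This is the telescoping device: each point is labelled by the number of points before
  it, so a sum of \<open>h\<close> of the left limits over the points in \<open>(s, t]\<close>
  becomes a sum of \<open>h\<close> over consecutive integers.\<close>

lemma bij_betw_count_before:
  assumes fin: "\<And>t. finite (P \<omega> \<inter> {0<..t})" and "0 \<le> s" and "s \<le> t"
  shows "bij_betw (\<lambda>u. count_before P u \<omega>) (P \<omega> \<inter> {s<..t}) {count_upto P s \<omega>..<count_upto P t \<omega>}"
proof -
  let ?f = "\<lambda>u. count_before P u \<omega>" and ?A = "P \<omega> \<inter> {s<..t}"
  have fin': "finite (P \<omega> \<inter> {0<..<u})" for u
    by (rule finite_subset[OF _ fin[of u]]) auto
  have split: "P \<omega> \<inter> {0<..t} = (P \<omega> \<inter> {0<..s}) \<union> ?A"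
    using \<open>0 \<le> s\<close> \<open>s \<le> t\<close> by auto
  have finA: "finite ?A"
    using fin[of t] split by simp
  have card: "card ?A = count_upto P t \<omega> - count_upto P s \<omega>"
    unfolding count_upto_def split using fin finA by (subst card_Un_disjoint) auto
  have mono: "?f u < ?f v" if "u \<in> ?A" "v \<in> ?A" "u < v" for u v
    unfolding count_before_def
    using that \<open>0 \<le> s\<close> fin' by (intro psubset_card_mono) force+
  have inj: "inj_on ?f ?A"
    by (intro linorder_inj_onI') (metis mono less_irrefl)
  have "count_upto P s \<omega> \<le> ?f u" "?f u < count_upto P t \<omega>" if "u \<in> ?A" for u
  proof -
    show "count_upto P s \<omega> \<le> ?f u"
      unfolding count_before_def count_upto_def using that fin' by (intro card_mono) auto
    show "?f u < count_upto P t \<omega>"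
      unfolding count_before_def count_upto_def
      using that \<open>0 \<le> s\<close> fin by (intro psubset_card_mono) force+
  qed
  then have "?f ` ?A \<subseteq> {count_upto P s \<omega>..<count_upto P t \<omega>}"
    by auto
  \<comment> \<open>Surjectivity comes from counting: an injective image inside a finite set of the
    same cardinality fills it.\<close>
  moreover have "card (?f ` ?A) = card {count_upto P s \<omega>..<count_upto P t \<omega>}"
    using card by (simp add: card_image[OF inj])
  ultimately show ?thesis
    using inj by (simp add: bij_betw_def card_subset_eq)
qed

section \<open>Moments of the counting process through its intensity\<close>

context
  fixes M :: "'a measure" and P :: "'a \<Rightarrow> real set"
  assumes spp: "simple_point_process M P"
begin

lemma finite_points: "\<omega> \<in> space M \<Longrightarrow> finite (P \<omega> \<inter> {0<..t})"
  using spp by (auto simp: simple_point_process_def)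

lemma measurable_count_upto [measurable]: "count_upto P t \<in> measurable M (count_space UNIV)"
  using spp by (auto simp: simple_point_process_def)

section \<open>Joint and predictable measurability of the counts\<close>

lemma measurable_count_before_pair:
  "(\<lambda>(u, \<omega>). count_before P u \<omega>) \<in> measurable (borel \<Otimes>\<^sub>M M) (count_space UNIV)"
proof (rule measurable_nat_geI)
  fix k :: nat
  let ?S = "{x \<in> space (borel \<Otimes>\<^sub>M M). k \<le> (case x of (u, \<omega>) \<Rightarrow> count_before P u \<omega>)}"
  show "?S \<in> sets (borel \<Otimes>\<^sub>M M)"
  proof (cases "k = 0")
    case False
    then have "?S = (\<Union>q\<in>\<rat> \<inter> {0..}. {q<..} \<times> {\<omega> \<in> space M. k \<le> count_upto P q \<omega>})"
      using count_before_ge_iff[where P=P, OF finite_points] by (auto simp: space_pair_measure)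
    also have "\<dots> \<in> sets (borel \<Otimes>\<^sub>M M)"
      by (intro sets.countable_UN') (auto simp: countable_rat)
    finally show ?thesis .
  qed auto
qed

lemma measurable_count_upto_pair [measurable]:
  "(\<lambda>(u, \<omega>). count_upto P u \<omega>) \<in> measurable (borel \<Otimes>\<^sub>M M) (count_space UNIV)"
proof (rule measurable_nat_geI)
  fix k :: nat
  have [measurable]: "(\<lambda>x. count_before P (fst x + c) (snd x)) \<in> measurable (borel \<Otimes>\<^sub>M M) (count_space UNIV)" for c
    using measurable_compose[of "\<lambda>x. (fst x + c, snd x)" "borel \<Otimes>\<^sub>M M" "borel \<Otimes>\<^sub>M M",
        OF _ measurable_count_before_pair] by simp
  have "{x \<in> space (borel \<Otimes>\<^sub>M M). k \<le> (case x of (u, \<omega>) \<Rightarrow> count_upto P u \<omega>)}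
      = {x \<in> space (borel \<Otimes>\<^sub>M M). \<forall>n. k \<le> count_before P (fst x + 1 / real (Suc n)) (snd x)}"
    by (intro Collect_cong conj_cong refl)
       (auto simp: space_pair_measure count_upto_ge_iff[where P=P, OF finite_points])
  also have "\<dots> \<in> sets (borel \<Otimes>\<^sub>M M)"
    by measurable
  finally show "{x \<in> space (borel \<Otimes>\<^sub>M M). k \<le> (case x of (u, \<omega>) \<Rightarrow> count_upto P u \<omega>)}
      \<in> sets (borel \<Otimes>\<^sub>M M)" .
qed

lemma space_predictable [simp]: "space (predictable M F) = {0<..} \<times> space M"
  by (simp add: predictable_def space_measure_of_conv)

lemma sets_predictable:
  assumes "\<And>a. subalgebra M (F a)" and "0 \<le> a" and "A \<in> sets (F a)"
  shows "{a<..b} \<times> A \<in> sets (predictable M F)"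
proof (cases "a \<le> b")
  case True
  have "A \<subseteq> space M" if "A \<in> sets (F a)" for a A
    using that assms(1)[of a] sets.sets_into_space by (fastforce simp: subalgebra_def)
  then have "{{a<..b} \<times> A | a b A. 0 \<le> a \<and> a \<le> b \<and> A \<in> sets (F a)} \<subseteq> Pow ({0<..} \<times> space M)"
    by fastforce
  then show ?thesis
    unfolding predictable_def using True assms(2,3) by (subst sets_measure_of) auto
qed auto

lemma measurable_count_before_predictable:
  assumes sub: "\<And>a. subalgebra M (F a)"
    and F: "\<And>a. count_upto P a \<in> measurable (F a) (count_space UNIV)"
  shows "(\<lambda>(u, \<omega>). count_before P u \<omega>) \<in> measurable (predictable M F) (count_space UNIV)"
proof (rule measurable_nat_geI)
  fix k :: nat
  let ?S = "{x \<in> space (predictable M F). k \<le> (case x of (u, \<omega>) \<Rightarrow> count_before P u \<omega>)}"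
  show "?S \<in> sets (predictable M F)"
  proof (cases "k = 0")
    case False
    \<comment> \<open>The half-lines \<open>(q, \<infinity>)\<close> must be exhausted by intervals
      \<open>(q, q + n]\<close>, since the generators of the predictable sigma-algebra are
      rectangles over bounded intervals. The event attached to \<open>q\<close> lies in
      \<open>F q\<close> because the count is adapted.\<close>
    have "\<exists>n. u \<le> q + real n" for u q
      using real_arch_simple[of "u - q"] by (auto simp: algebra_simps)
    then have "?S = (\<Union>q\<in>\<rat> \<inter> {0..}. \<Union>n::nat. {q<..q + real n} \<times> {\<omega> \<in> space M. k \<le> count_upto P q \<omega>})"
      using False count_before_ge_iff[where P=P, OF finite_points] by fastforce
    also have "\<dots> \<in> sets (predictable M F)"
    proof (intro sets.countable_UN' sets.countable_UN image_subsetI sets_predictable[OF sub])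
      fix q :: real
      have [measurable]: "count_upto P q \<in> measurable (F q) (count_space UNIV)"
        by (rule F)
      have "{\<omega> \<in> space (F q). k \<le> count_upto P q \<omega>} \<in> sets (F q)"
        by measurable
      then show "{\<omega> \<in> space M. k \<le> count_upto P q \<omega>} \<in> sets (F q)"
        using sub[of q] unfolding subalgebra_def by metis
    qed (auto simp: countable_rat)
    finally show ?thesis .
  next
    case True
    then have "?S = space (predictable M F)"
      by auto
    then show ?thesis
      by (metis sets.top)
  qed
qed

text \<open>The defining identity of the intensity is applied to the predictable process
  \<open>C\<close> equal to \<open>g\<close> of the count at \<open>s\<close> times \<open>h\<close>
  of the left limit on \<open>(s, t]\<close>, and zero elsewhere. Values are extended nonnegative,
  so the identity is available before any moment is known to be finite.\<close>

lemma nn_integral_sum_count_upto: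
  fixes g h :: "nat \<Rightarrow> ennreal" and l :: "real \<Rightarrow> nat \<Rightarrow> real"
  assumes int: "stochastic_intensity M P F (\<lambda>u \<omega>. l u (count_before P u \<omega>))"
    and sf: "sigma_finite_measure M"
    and l [measurable]: "\<And>k. (\<lambda>u. l u k) \<in> borel_measurable borel"
    and s: "0 \<le> s" and st: "s \<le> t"
  shows "(\<integral>\<^sup>+\<omega>. g (count_upto P s \<omega>) * (\<Sum>k\<in>{count_upto P s \<omega>..<count_upto P t \<omega>}. h k) \<partial>M)
    = (\<integral>\<^sup>+u\<in>{s..t}. (\<integral>\<^sup>+\<omega>. g (count_upto P s \<omega>) * h (count_upto P u \<omega>)
          * ennreal (l u (count_upto P u \<omega>)) \<partial>M) \<partial>lborel)"
proof -
  interpret sigma_finite_measure M by (rule sf)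
  interpret pair_sigma_finite lborel M ..
  have sub: "\<And>a. subalgebra M (F a)"
    and F: "\<And>a. count_upto P a \<in> measurable (F a) (count_space UNIV)"
    using int by (auto simp: stochastic_intensity_def)
  \<comment> \<open>The shift by one lets the value \<open>0\<close> mark the complement of \<open>(s, t]\<close>.\<close>
  define K where "K = (\<lambda>(u, \<omega>). if s < u \<and> u \<le> t then Suc (count_upto P s \<omega>) else 0)"
  define G where "G = (\<lambda>k. case k of 0 \<Rightarrow> 0 | Suc j \<Rightarrow> g j)"
  \<comment> \<open>For \<open>k = Suc j\<close> the event \<open>k \<le> K x\<close> is a single
    generating rectangle over \<open>(s, t]\<close>, whose base is
    \<open>F s\<close>-measurable.\<close>
  have K [measurable]: "K \<in> measurable (predictable M F) (count_space UNIV)"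
  proof (rule measurable_nat_geI)
    fix k :: nat
    show "{x \<in> space (predictable M F). k \<le> K x} \<in> sets (predictable M F)"
    proof (cases k)
      case 0
      then have "{x \<in> space (predictable M F). k \<le> K x} = space (predictable M F)"
        by auto
      then show ?thesis
        by (metis sets.top)
    next
      case (Suc j)
      have [measurable]: "count_upto P s \<in> measurable (F s) (count_space UNIV)"
        by (rule F)
      have "{\<omega> \<in> space (F s). j \<le> count_upto P s \<omega>} \<in> sets (F s)"
        by measurable
      then have "{\<omega> \<in> space M. j \<le> count_upto P s \<omega>} \<in> sets (F s)"
        using sub[of s] unfolding subalgebra_def by metis
      then have "{s<..t} \<times> {\<omega> \<in> space M. j \<le> count_upto P s \<omega>} \<in> sets (predictable M F)"
        using s by (intro sets_predictable[OF sub])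
      also have "{s<..t} \<times> {\<omega> \<in> space M. j \<le> count_upto P s \<omega>}
          = {x \<in> space (predictable M F). k \<le> K x}"
        using s Suc by (auto simp: K_def split: if_splits)
      finally show ?thesis .
    qed
  qed
  define C where "C = (\<lambda>x. G (K x) * h (case x of (u, \<omega>) \<Rightarrow> count_before P u \<omega>))"
  have C_eq: "C (u, \<omega>) = g (count_upto P s \<omega>) * h (count_before P u \<omega>) * indicator {s<..t} u" for u \<omega>
    by (auto simp: C_def G_def K_def)
  have "C \<in> borel_measurable (predictable M F)"
    unfolding C_def using measurable_count_before_predictable[OF sub F] by measurable
  then have main: "(\<integral>\<^sup>+\<omega>. (\<integral>\<^sup>+u. C (u, \<omega>) \<partial>count_space (P \<omega>)) \<partial>M) =
      (\<integral>\<^sup>+\<omega>. (\<integral>\<^sup>+u\<in>{0<..}. C (u, \<omega>) * ennreal (l u (count_before P u \<omega>)) \<partial>lborel) \<partial>M)"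
    using int by (auto simp: stochastic_intensity_def)
  have left: "(\<integral>\<^sup>+u. C (u, \<omega>) \<partial>count_space (P \<omega>))
      = g (count_upto P s \<omega>) * (\<Sum>k\<in>{count_upto P s \<omega>..<count_upto P t \<omega>}. h k)"
    if \<omega>: "\<omega> \<in> space M" for \<omega>
  proof -
    have fin: "finite (P \<omega> \<inter> {s<..t})"
      using s by (intro finite_subset[OF _ finite_points[OF \<omega>, of t]]) auto
    have "(\<integral>\<^sup>+u. C (u, \<omega>) \<partial>count_space (P \<omega>))
        = (\<integral>\<^sup>+u. g (count_upto P s \<omega>) * h (count_before P u \<omega>) \<partial>count_space (P \<omega> \<inter> {s<..t}))"
      unfolding C_eq by (subst nn_integral_count_space_indicator, simp, subst (2) nn_integral_count_space_indicator)
        (auto intro!: nn_integral_cong simp: indicator_def)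
    also have "\<dots> = (\<Sum>u\<in>P \<omega> \<inter> {s<..t}. g (count_upto P s \<omega>) * h (count_before P u \<omega>))"
      using fin by (rule nn_integral_count_space_finite)
    also have "\<dots> = g (count_upto P s \<omega>) * (\<Sum>u\<in>P \<omega> \<inter> {s<..t}. h (count_before P u \<omega>))"
      by (simp add: sum_distrib_left)
    also have "(\<Sum>u\<in>P \<omega> \<inter> {s<..t}. h (count_before P u \<omega>))
        = (\<Sum>k\<in>{count_upto P s \<omega>..<count_upto P t \<omega>}. h k)"
      by (rule sum.reindex_bij_betw[OF bij_betw_count_before[where P=P, OF finite_points[OF \<omega>] s st]])
    finally show ?thesis .
  qed
  \<comment> \<open>Two changes on null sets of times: the left limits become counts, and
    \<open>(s, t]\<close> becomes \<open>{s..t}\<close> by adding the single time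
    \<open>s\<close>.\<close>
  have right: "(\<integral>\<^sup>+u\<in>{0<..}. C (u, \<omega>) * ennreal (l u (count_before P u \<omega>)) \<partial>lborel)
      = (\<integral>\<^sup>+u. g (count_upto P s \<omega>) * h (count_upto P u \<omega>)
          * ennreal (l u (count_upto P u \<omega>)) * indicator {s..t} u \<partial>lborel)"
    if \<omega>: "\<omega> \<in> space M" for \<omega>
  proof (rule nn_integral_cong_AE)
    show "AE u in lborel. C (u, \<omega>) * ennreal (l u (count_before P u \<omega>)) * indicator {0<..} u
        = g (count_upto P s \<omega>) * h (count_upto P u \<omega>) * ennreal (l u (count_upto P u \<omega>)) * indicator {s..t} u"
      using AE_count_before_eq_count_upto[where P=P, OF finite_points[OF \<omega>]] AE_lborel_singleton[of s]
    proof eventually_elim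
      case (elim u)
      then show ?case
        using s by (auto simp: C_eq indicator_def)
    qed
  qed
  have [measurable]: "(\<lambda>(u, \<omega>). l u (count_upto P u \<omega>)) \<in> borel_measurable (borel \<Otimes>\<^sub>M M)"
  proof -
    \<comment> \<open>The count takes countably many values, so measurability of \<open>l\<close> in
      time for each fixed value suffices.\<close>
    have "(\<lambda>x. l (fst x) ((\<lambda>(u, \<omega>). count_upto P u \<omega>) x)) \<in> borel_measurable (borel \<Otimes>\<^sub>M M)"
      by (rule measurable_compose_countable) measurable
    then show ?thesis
      by (simp add: case_prod_unfold)
  qed
  have "(\<integral>\<^sup>+\<omega>. g (count_upto P s \<omega>) * (\<Sum>k\<in>{count_upto P s \<omega>..<count_upto P t \<omega>}. h k) \<partial>M)
      = (\<integral>\<^sup>+\<omega>. (\<integral>\<^sup>+u. C (u, \<omega>) \<partial>count_space (P \<omega>)) \<partial>M)"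
    by (intro nn_integral_cong) (simp add: left)
  also have "\<dots> = (\<integral>\<^sup>+\<omega>. (\<integral>\<^sup>+u. g (count_upto P s \<omega>) * h (count_upto P u \<omega>)
          * ennreal (l u (count_upto P u \<omega>)) * indicator {s..t} u \<partial>lborel) \<partial>M)"
    unfolding main by (intro nn_integral_cong right)
  also have "\<dots> = (\<integral>\<^sup>+u. (\<integral>\<^sup>+\<omega>. g (count_upto P s \<omega>) * h (count_upto P u \<omega>)
          * ennreal (l u (count_upto P u \<omega>)) * indicator {s..t} u \<partial>M) \<partial>lborel)"
    by (rule Fubini') measurable
  also have "\<dots> = (\<integral>\<^sup>+u\<in>{s..t}. (\<integral>\<^sup>+\<omega>. g (count_upto P s \<omega>) * h (count_upto P u \<omega>)
          * ennreal (l u (count_upto P u \<omega>)) \<partial>M) \<partial>lborel)"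
    by (intro nn_integral_cong) (auto simp: indicator_def)
  finally show ?thesis .
qed

end

section \<open>Linear integral inequalities and equations\<close>

text \<open>
  The supremum \<open>K\<close> of \<open>x u * exp (- 2 c (u - s))\<close> satisfies \<open>K \<le> A + K / 2\<close>.
\<close>

lemma gronwall_nn_integral:
  fixes x :: "real \<Rightarrow> real"
  assumes bdd: "\<And>u. u \<in> {s..T} \<Longrightarrow> x u \<le> B" and nonneg: "\<And>u. u \<in> {s..T} \<Longrightarrow> 0 \<le> x u"
    and "0 \<le> A" and "0 < c" and "s \<le> T"
    and ineq: "\<And>t. t \<in> {s..T} \<Longrightarrow> ennreal (x t) \<le> ennreal A + (\<integral>\<^sup>+u\<in>{s..t}. ennreal (c * x u) \<partial>lborel)"
  shows "x T \<le> 2 * A * exp (2 * c * (T - s))"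
proof -
  define y where "y u = x u * exp (- (2 * c * (u - s)))" for u
  define K where "K = (SUP u\<in>{s..T}. y u)"
  have y_nonneg: "0 \<le> y u" if "u \<in> {s..T}" for u
    using nonneg[OF that] by (simp add: y_def)
  have "y u \<le> B" if "u \<in> {s..T}" for u
  proof -
    have "y u \<le> x u * 1"
      unfolding y_def using that nonneg[OF that] \<open>0 < c\<close> by (intro mult_left_mono) auto
    then show ?thesis
      using bdd[OF that] by simp
  qed
  \<comment> \<open>The a priori bound \<open>B\<close> makes \<open>K\<close> a genuine real
    supremum, so that \<open>K / 2\<close> can be subtracted at the end. \<open>B\<close> does not
    enter the final estimate, which is what lets the truncation level disappear later.\<close>
  then have "bdd_above (y ` {s..T})"
    by (rule bdd_aboveI2)
  then have y_le: "y u \<le> K" if "u \<in> {s..T}" for u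
    unfolding K_def using that by (rule cSUP_upper[rotated])
  have K: "0 \<le> K"
    using y_le[of s] y_nonneg[of s] \<open>s \<le> T\<close> by auto
  have x_eq: "x u = y u * exp (2 * c * (u - s))" for u
    by (simp add: y_def exp_minus)
  have "y t \<le> A + K / 2" if t: "t \<in> {s..T}" for t
  proof -
    let ?E = "\<lambda>u. exp (2 * c * (u - s))"
    \<comment> \<open>The rate \<open>2 * c\<close> in the weight is twice the rate of the
      inequality, so the integral of \<open>c * K * ?E u\<close> has antiderivative
      \<open>K / 2 * ?E u\<close>. This is where the factor one half arises.\<close>
    have "(\<integral>\<^sup>+u\<in>{s..t}. ennreal (c * x u) \<partial>lborel) \<le> (\<integral>\<^sup>+u. ennreal (c * K * ?E u) * indicator {s..t} u \<partial>lborel)"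
    proof (intro nn_integral_mono)
      fix u
      show "ennreal (c * x u) * indicator {s..t} u \<le> ennreal (c * K * ?E u) * indicator {s..t} u"
      proof (cases "u \<in> {s..t}")
        case True
        then have "x u \<le> K * ?E u"
          unfolding x_eq using t y_le[of u] by (intro mult_right_mono) auto
        then show ?thesis
          using \<open>0 < c\<close> True by (auto simp: indicator_def mult.assoc intro!: ennreal_leI mult_left_mono)
      qed auto
    qed
    also have "\<dots> = ennreal (K / 2 * ?E t - K / 2 * ?E s)"
    proof (rule nn_integral_FTC_Icc[where F="\<lambda>u. K / 2 * ?E u"])
      show "((\<lambda>u. K / 2 * ?E u) has_real_derivative c * K * ?E u) (at u)" for u
        by (auto intro!: derivative_eq_intros)
    qed (use t K \<open>0 < c\<close> in auto)
    finally have "ennreal (x t) \<le> ennreal A + ennreal (K / 2 * ?E t - K / 2)"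
      using ineq[OF t] by (auto intro: order.trans add_left_mono)
    moreover have E1: "1 \<le> ?E t"
      using t \<open>0 < c\<close> by auto
    then have "K / 2 * 1 \<le> K / 2 * ?E t"
      using K by (intro mult_left_mono) auto
    ultimately have "ennreal (x t) \<le> ennreal (A + (K / 2 * ?E t - K / 2))"
      using \<open>0 \<le> A\<close> by (simp add: ennreal_plus[symmetric] del: ennreal_plus)
    then have "x t \<le> A + (K / 2 * ?E t - K / 2)"
      using \<open>0 \<le> A\<close> \<open>K / 2 * 1 \<le> K / 2 * ?E t\<close> by (subst (asm) ennreal_le_iff) auto
    \<comment> \<open>Since \<open>?E t\<close> is at least 1, the constant \<open>A\<close> can
      carry the weight too, and \<open>?E t\<close> can then be cancelled.\<close>
    also have "\<dots> \<le> A * ?E t + K / 2 * ?E t"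
      using mult_left_mono[OF E1 \<open>0 \<le> A\<close>] K by auto
    finally have "y t * ?E t \<le> (A + K / 2) * ?E t"
      unfolding x_eq by (simp add: algebra_simps)
    then show ?thesis
      by simp
  qed
  then have "K \<le> A + K / 2"
    unfolding K_def using \<open>s \<le> T\<close> by (intro cSUP_least) auto
  then have "y T \<le> 2 * A"
    using y_le[of T] \<open>s \<le> T\<close> by auto
  then show ?thesis
    unfolding x_eq by (intro mult_right_mono) auto
qed

text \<open>Both functions solve the same integral equation, \<open>y\<close> by the fundamental
  theorem of calculus. Their distance then satisfies Gronwall's inequality with \<open>A = 0\<close>
  and vanishes. A moment can thus be identified by guessing a solution \<open>y\<close> of the
  differential equation, without knowing beforehand that the moment is differentiable.\<close>

lemma linear_integral_equation_eq_solution: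
  fixes x y a b :: "real \<Rightarrow> real"
  assumes "s \<le> T"
    and nonneg: "\<And>u. 0 \<le> x u" "\<And>u. u \<in> {s..T} \<Longrightarrow> 0 \<le> y u"
      "\<And>u. u \<in> {s..T} \<Longrightarrow> 0 \<le> a u" "\<And>u. u \<in> {s..T} \<Longrightarrow> 0 \<le> b u"
    and "0 < c" and b: "\<And>u. u \<in> {s..T} \<Longrightarrow> b u \<le> c"
    and [measurable]: "x \<in> borel_measurable borel" "y \<in> borel_measurable borel"
      "a \<in> borel_measurable borel" "b \<in> borel_measurable borel"
    and x: "\<And>t. t \<in> {s..T} \<Longrightarrow>
      ennreal (x t) = ennreal (y s) + (\<integral>\<^sup>+u\<in>{s..t}. ennreal (a u + b u * x u) \<partial>lborel)"
    and deriv: "\<And>u. u \<in> {s..T} \<Longrightarrow> (y has_real_derivative a u + b u * y u) (at u)"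
  shows "x T = y T"
proof -
  have mono_y: "y u \<le> y v" if "u \<in> {s..T}" "v \<in> {s..T}" "u \<le> v" for u v
  proof (rule DERIV_nonneg_imp_nondecreasing[where f=y, OF \<open>u \<le> v\<close>])
    fix w assume "u \<le> w" "w \<le> v"
    then have w: "w \<in> {s..T}"
      using that by auto
    then show "\<exists>d. (y has_real_derivative d) (at w) \<and> 0 \<le> d"
      using deriv[OF w] nonneg(2-4)[OF w] by (intro exI[of _ "a w + b w * y w"]) auto
  qed
  have y: "ennreal (y t) = ennreal (y s) + (\<integral>\<^sup>+u\<in>{s..t}. ennreal (a u + b u * y u) \<partial>lborel)"
    if t: "t \<in> {s..T}" for t
  proof -
    have "(\<integral>\<^sup>+u\<in>{s..t}. ennreal (a u + b u * y u) \<partial>lborel) = ennreal (y t - y s)"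
    proof (rule nn_integral_FTC_Icc[where F=y])
      fix u assume "u \<in> {s..t}"
      then have u: "u \<in> {s..T}"
        using t by auto
      show "(y has_real_derivative a u + b u * y u) (at u)"
        by (rule deriv[OF u])
      show "0 \<le> a u + b u * y u"
        using nonneg(2-4)[OF u] by simp
    qed (use t in auto)
    then show ?thesis
      using mono_y[of s t] t nonneg(2)[of s] \<open>s \<le> T\<close>
      by (simp add: ennreal_plus[symmetric] del: ennreal_plus)
  qed
  \<comment> \<open>The integrals grow with the interval, so \<open>x\<close> is nondecreasing. This
    supplies the a priori bound on the distance that Gronwall's inequality asks for.\<close>
  have mono_x: "x u \<le> x T" if u: "u \<in> {s..T}" for u
  proof -
    have "(\<integral>\<^sup>+v\<in>{s..u}. ennreal (a v + b v * x v) \<partial>lborel)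
        \<le> (\<integral>\<^sup>+v\<in>{s..T}. ennreal (a v + b v * x v) \<partial>lborel)"
      using u by (intro nn_integral_mono) (auto simp: indicator_def)
    then have "ennreal (x u) \<le> ennreal (x T)"
      using x[OF u] x[of T] \<open>s \<le> T\<close> by (simp add: add_left_mono)
    then show ?thesis
      using nonneg(1) by simp
  qed
  have bdd: "\<bar>x u - y u\<bar> \<le> x T + y T" if "u \<in> {s..T}" for u
    using mono_x[OF that] mono_y[OF that, of T] that nonneg(1)[of u] nonneg(2)[OF that] by auto
  let ?d = "\<lambda>u. \<bar>x u - y u\<bar>"
  \<comment> \<open>Extended nonnegative integrals cannot be subtracted freely, so the bound on the
    absolute difference is split into two one-sided inequalities. Both are instances of this step,
    with the roles of \<open>x\<close> and \<open>y\<close> exchanged.\<close>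
  have step: "ennreal (v t) \<le> ennreal (w t) + (\<integral>\<^sup>+u\<in>{s..t}. ennreal (c * ?d u) \<partial>lborel)"
    if t: "t \<in> {s..T}"
      and v: "ennreal (v t) = ennreal (y s) + (\<integral>\<^sup>+u\<in>{s..t}. ennreal (a u + b u * v u) \<partial>lborel)"
      and w: "ennreal (w t) = ennreal (y s) + (\<integral>\<^sup>+u\<in>{s..t}. ennreal (a u + b u * w u) \<partial>lborel)"
      and w0: "\<And>u. u \<in> {s..T} \<Longrightarrow> 0 \<le> w u"
      and vw: "\<And>u. v u \<le> w u + ?d u"
      and [measurable]: "w \<in> borel_measurable borel"
    for t v w
  proof -
    have "(\<integral>\<^sup>+u\<in>{s..t}. ennreal (a u + b u * v u) \<partial>lborel)
        \<le> (\<integral>\<^sup>+u. ennreal (a u + b u * w u) * indicator {s..t} u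
             + ennreal (c * ?d u) * indicator {s..t} u \<partial>lborel)"
    proof (intro nn_integral_mono)
      fix u
      show "ennreal (a u + b u * v u) * indicator {s..t} u \<le> ennreal (a u + b u * w u) * indicator {s..t} u
             + ennreal (c * ?d u) * indicator {s..t} u"
      proof (cases "u \<in> {s..t}")
        case True
        then have u: "u \<in> {s..T}"
          using t by auto
        have "b u * v u \<le> b u * w u + b u * ?d u"
          using mult_left_mono[OF vw nonneg(4)[OF u]] by (simp add: algebra_simps)
        moreover have "b u * ?d u \<le> c * ?d u"
          using b[OF u] by (intro mult_right_mono) auto
        ultimately have "ennreal (a u + b u * v u) \<le> ennreal ((a u + b u * w u) + c * ?d u)"
          by (intro ennreal_leI) auto
        also have "\<dots> = ennreal (a u + b u * w u) + ennreal (c * ?d u)"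
          using nonneg(3,4)[OF u] w0[OF u] \<open>0 < c\<close> by (intro ennreal_plus) auto
        finally show ?thesis
          using True by simp
      qed auto
    qed
    also have "\<dots> = (\<integral>\<^sup>+u\<in>{s..t}. ennreal (a u + b u * w u) \<partial>lborel)
        + (\<integral>\<^sup>+u\<in>{s..t}. ennreal (c * ?d u) \<partial>lborel)"
      by (intro nn_integral_add) auto
    finally show ?thesis
      unfolding v w by (simp add: add.assoc add_left_mono)
  qed
  have "ennreal (?d t) \<le> ennreal 0 + (\<integral>\<^sup>+u\<in>{s..t}. ennreal (c * ?d u) \<partial>lborel)" (is "_ \<le> _ + ?I")
    if t: "t \<in> {s..T}" for t
  proof -
    have "ennreal (x t) \<le> ennreal (y t) + ?I"
      by (rule step[OF t x[OF t] y[OF t]]) (auto simp: nonneg(2))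
    moreover have "ennreal (y t) \<le> ennreal (x t) + ?I"
      by (rule step[OF t y[OF t] x[OF t]]) (auto simp: nonneg(1))
    ultimately show ?thesis
      using nonneg(1)[of t] nonneg(2)[OF t] by (cases ?I) (auto simp: ennreal_plus[symmetric] abs_if simp del: ennreal_plus)
  qed
  then have "?d T \<le> 2 * 0 * exp (2 * c * (T - s))"
    using bdd \<open>0 < c\<close> \<open>s \<le> T\<close> by (intro gronwall_nn_integral[where B="x T + y T"]) auto
  then show ?thesis
    by simp
qed

section \<open>The process with intensity \<open>\<beta> + N / (u + 1)\<close>\<close>

lemma sum_odd_nat: "(\<Sum>k<n. 2 * real k + 1) = (real n)\<^sup>2"
  by (induction n) (auto simp: power2_eq_square algebra_simps)

context
  fixes M :: "'a measure" and P :: "'a \<Rightarrow> real set" and F :: "real \<Rightarrow> 'a measure" and \<beta> :: real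
  assumes prob: "prob_space M" and \<beta>: "0 < \<beta>" and spp: "simple_point_process M P"
    and int: "stochastic_intensity M P F (\<lambda>u \<omega>. \<beta> + real (count_before P u \<omega>) / (u + 1))"
begin

interpretation prob_space M by (rule prob)

declare measurable_count_upto [OF spp, measurable]

abbreviation (input) N :: "real \<Rightarrow> 'a \<Rightarrow> real" where "N u \<omega> \<equiv> real (count_upto P u \<omega>)"

lemma count_upto_nonpos: "u \<le> 0 \<Longrightarrow> count_upto P u = (\<lambda>\<omega>. 0)"
  by (auto simp: count_upto_def)

text \<open>Integrability over the probability space turns both inner integrals into real
  expectations. The time integral stays extended nonnegative, the form used in the lemmas on
  integral inequalities and equations.\<close>

lemma expectation_sum_count_upto:
  fixes g h :: "nat \<Rightarrow> real"
  assumes "\<And>k. 0 \<le> g k" and "\<And>k. 0 \<le> h k" and "0 \<le> s" and "s \<le> t"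
    and "integrable M (\<lambda>\<omega>. g (count_upto P s \<omega>) * (\<Sum>k\<in>{count_upto P s \<omega>..<count_upto P t \<omega>}. h k))"
    and "\<And>u. u \<in> {s..t} \<Longrightarrow>
      integrable M (\<lambda>\<omega>. g (count_upto P s \<omega>) * h (count_upto P u \<omega>) * (\<beta> + N u \<omega> / (u + 1)))"
  shows "ennreal (expectation (\<lambda>\<omega>. g (count_upto P s \<omega>) * (\<Sum>k\<in>{count_upto P s \<omega>..<count_upto P t \<omega>}. h k)))
    = (\<integral>\<^sup>+u\<in>{s..t}. ennreal (expectation (\<lambda>\<omega>. g (count_upto P s \<omega>) * h (count_upto P u \<omega>)
          * (\<beta> + N u \<omega> / (u + 1)))) \<partial>lborel)"
proof -
  have "ennreal (expectation (\<lambda>\<omega>. g (count_upto P s \<omega>) * (\<Sum>k\<in>{count_upto P s \<omega>..<count_upto P t \<omega>}. h k)))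
    = (\<integral>\<^sup>+\<omega>. ennreal (g (count_upto P s \<omega>) * (\<Sum>k\<in>{count_upto P s \<omega>..<count_upto P t \<omega>}. h k)) \<partial>M)"
    using assms by (intro nn_integral_eq_integral[symmetric]) (auto intro!: mult_nonneg_nonneg sum_nonneg)
  also have "\<dots> = (\<integral>\<^sup>+\<omega>. ennreal (g (count_upto P s \<omega>))
      * (\<Sum>k\<in>{count_upto P s \<omega>..<count_upto P t \<omega>}. ennreal (h k)) \<partial>M)"
    using assms by (simp add: ennreal_mult sum_nonneg)
  also have "\<dots> = (\<integral>\<^sup>+u\<in>{s..t}. (\<integral>\<^sup>+\<omega>. ennreal (g (count_upto P s \<omega>)) * ennreal (h (count_upto P u \<omega>))
          * ennreal (\<beta> + N u \<omega> / (u + 1)) \<partial>M) \<partial>lborel)"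
    using assms(3,4)
    by (intro nn_integral_sum_count_upto[OF spp int, where g="\<lambda>k. ennreal (g k)" and h="\<lambda>k. ennreal (h k)"]
        sigma_finite_measure_axioms) auto
  also have "\<dots> = (\<integral>\<^sup>+u\<in>{s..t}. ennreal (expectation (\<lambda>\<omega>. g (count_upto P s \<omega>) * h (count_upto P u \<omega>)
          * (\<beta> + N u \<omega> / (u + 1)))) \<partial>lborel)"
  proof (intro nn_integral_cong)
    fix u
    have "(\<integral>\<^sup>+\<omega>. ennreal (g (count_upto P s \<omega>)) * ennreal (h (count_upto P u \<omega>))
          * ennreal (\<beta> + N u \<omega> / (u + 1)) \<partial>M)
        = ennreal (expectation (\<lambda>\<omega>. g (count_upto P s \<omega>) * h (count_upto P u \<omega>) * (\<beta> + N u \<omega> / (u + 1))))"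
      if u: "u \<in> {s..t}"
    proof -
      have "0 \<le> \<beta> + N u \<omega> / (u + 1)" for \<omega>
        using u \<open>0 \<le> s\<close> \<beta> by auto
      then show ?thesis
        using assms(1,2) assms(6)[OF u]
        by (subst nn_integral_eq_integral[symmetric]) (auto simp: ennreal_mult)
    qed
    then show "(\<integral>\<^sup>+\<omega>. ennreal (g (count_upto P s \<omega>)) * ennreal (h (count_upto P u \<omega>))
          * ennreal (\<beta> + N u \<omega> / (u + 1)) \<partial>M) * indicator {s..t} u
        = ennreal (expectation (\<lambda>\<omega>. g (count_upto P s \<omega>) * h (count_upto P u \<omega>)
          * (\<beta> + N u \<omega> / (u + 1)))) * indicator {s..t} u"
      by (cases "u \<in> {s..t}") auto
  qed
  finally show ?thesis .
qed

section \<open>Finiteness of the second moments\<close>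

text \<open>
  Truncating at level \<open>n\<close> makes the second moment bounded a priori, so that Gronwall's
  inequality gives a bound that does not depend on \<open>n\<close>.
\<close>

lemma expectation_truncated_square_le:
  assumes T: "0 \<le> T"
  shows "expectation (\<lambda>\<omega>. (real (min (count_upto P T \<omega>) n))\<^sup>2)
    \<le> 2 * (\<beta> * T) * exp (2 * (2 * \<beta> + 3) * (T - 0))"
proof -
  define x where "x = (\<lambda>t. expectation (\<lambda>\<omega>. (real (min (count_upto P t \<omega>) n))\<^sup>2))"
  \<comment> \<open>These are the increments of the truncated square: summed from 0 they telescope
    to \<open>(min m n)^2\<close>.\<close>
  define h where "h = (\<lambda>k. if k < n then 2 * real k + 1 else 0)"
  have sq_le: "(real (min k n))\<^sup>2 \<le> (real n)\<^sup>2" for k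
    by (intro power_mono) auto
  have int_sq: "integrable M (\<lambda>\<omega>. (real (min (count_upto P t \<omega>) n))\<^sup>2)" for t
    by (rule integrable_const_bound[where B="(real n)\<^sup>2"]) (auto simp: sq_le simp del: of_nat_min)
  have x_le: "x t \<le> (real n)\<^sup>2" for t
    unfolding x_def by (intro integral_le_const int_sq) (auto simp: sq_le simp del: of_nat_min)
  have x_nonneg: "0 \<le> x t" for t
    unfolding x_def by (intro integral_nonneg_AE) auto
  have sum_h: "(\<Sum>k\<in>{0..<m}. h k) = (real (min m n))\<^sup>2" for m
  proof -
    have "(\<Sum>k\<in>{0..<m}. h k) = (\<Sum>k<min m n. 2 * real k + 1)"
      unfolding h_def by (intro sum.mono_neutral_cong_right) auto
    then show ?thesis
      by (simp add: sum_odd_nat)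
  qed
  \<comment> \<open>Below the truncation level,
    \<open>(2k + 1) (\<beta> + k) = \<beta> + (2 \<beta> + 1) k + 2 k^2\<close>, and
    \<open>k \<le> k^2\<close> for natural numbers, which gives the constant
    \<open>2 * \<beta> + 3\<close>. At and above the level \<open>h\<close> vanishes, so the
    truncated square alone controls the growth and the inequality closes.\<close>
  have h_le: "h k * (\<beta> + real k / (u + 1)) \<le> \<beta> + (2 * \<beta> + 3) * (real (min k n))\<^sup>2" if "0 \<le> u" for k u
  proof (cases "k < n")
    case True
    have k: "real k \<le> (real k)\<^sup>2"
      by (cases "k = 0") (auto simp: power2_eq_square)
    have "real k / (u + 1) \<le> real k"
      using that mult_left_mono[of 1 "u + 1" "real k"] by (simp add: divide_le_eq)
    then have "(2 * real k + 1) * (\<beta> + real k / (u + 1)) \<le> (2 * real k + 1) * (\<beta> + real k)"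
      by (intro mult_left_mono) auto
    also have "\<dots> = \<beta> + (2 * \<beta> + 1) * real k + 2 * (real k)\<^sup>2"
      by (simp add: algebra_simps power2_eq_square)
    also have "\<dots> \<le> \<beta> + (2 * \<beta> + 1) * (real k)\<^sup>2 + 2 * (real k)\<^sup>2"
      using \<beta> k by (intro add_mono mult_left_mono) auto
    finally show ?thesis
      using True by (simp add: h_def algebra_simps)
  next
    case False
    then show ?thesis
      using \<beta> by (simp add: h_def)
  qed
  have h_ge_0: "0 \<le> h k" for k
    by (simp add: h_def)
  have h_nonneg: "0 \<le> h k * (\<beta> + real k / (u + 1))" if "0 \<le> u" for k u
    using that \<beta> by (auto simp: h_def)
  have int_h: "integrable M (\<lambda>\<omega>. h (count_upto P u \<omega>) * (\<beta> + N u \<omega> / (u + 1)))" if "0 \<le> u" for u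
  proof (rule Bochner_Integration.integrable_bound)
    show "integrable M (\<lambda>\<omega>. \<beta> + (2 * \<beta> + 3) * (real (min (count_upto P u \<omega>) n))\<^sup>2)"
      using int_sq by (intro Bochner_Integration.integrable_add integrable_mult_right) auto
    show "AE \<omega> in M. norm (h (count_upto P u \<omega>) * (\<beta> + N u \<omega> / (u + 1)))
        \<le> norm (\<beta> + (2 * \<beta> + 3) * (real (min (count_upto P u \<omega>) n))\<^sup>2)"
      using order.trans[OF h_nonneg h_le, OF that that]
      by (intro AE_I2) (simp add: h_le h_nonneg that del: of_nat_min)
  qed measurable
  have "ennreal (x t) \<le> ennreal (\<beta> * T) + (\<integral>\<^sup>+u\<in>{0..t}. ennreal ((2 * \<beta> + 3) * x u) \<partial>lborel)"
    if t: "t \<in> {0..T}" for t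
  proof -
    have [measurable]: "x \<in> borel_measurable borel"
    proof (rule borel_measurable_mono, rule monoI)
      fix u v :: real assume "u \<le> v"
      then show "x u \<le> x v"
        unfolding x_def using count_upto_mono[where P=P, OF finite_points[OF spp]]
        by (intro integral_mono int_sq power_mono) (auto simp: min.coboundedI1)
    qed
    have "ennreal (x t) = (\<integral>\<^sup>+u\<in>{0..t}. ennreal (expectation (\<lambda>\<omega>. h (count_upto P u \<omega>)
          * (\<beta> + N u \<omega> / (u + 1)))) \<partial>lborel)"
      using expectation_sum_count_upto[of "\<lambda>_. 1" h 0 t] t int_sq[of t] int_h h_ge_0
      by (simp add: count_upto_nonpos sum_h x_def del: of_nat_min)
    also have "\<dots> \<le> (\<integral>\<^sup>+u. ennreal \<beta> * indicator {0..t} u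
        + ennreal ((2 * \<beta> + 3) * x u) * indicator {0..t} u \<partial>lborel)"
    proof (intro nn_integral_mono)
      fix u
      have "ennreal (expectation (\<lambda>\<omega>. h (count_upto P u \<omega>) * (\<beta> + N u \<omega> / (u + 1))))
          \<le> ennreal \<beta> + ennreal ((2 * \<beta> + 3) * x u)" if u: "0 \<le> u"
      proof -
        have "expectation (\<lambda>\<omega>. h (count_upto P u \<omega>) * (\<beta> + N u \<omega> / (u + 1)))
            \<le> expectation (\<lambda>\<omega>. \<beta> + (2 * \<beta> + 3) * (real (min (count_upto P u \<omega>) n))\<^sup>2)"
          using int_sq by (intro integral_mono int_h u h_le Bochner_Integration.integrable_add integrable_mult_right) auto
        also have "\<dots> = \<beta> + (2 * \<beta> + 3) * x u"
          unfolding x_def using int_sq[of u] by (simp add: prob_space del: of_nat_min)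
        finally show ?thesis
          using \<beta> x_nonneg[of u] by (simp add: ennreal_plus[symmetric] ennreal_leI del: ennreal_plus)
      qed
      then show "ennreal (expectation (\<lambda>\<omega>. h (count_upto P u \<omega>) * (\<beta> + N u \<omega> / (u + 1)))) * indicator {0..t} u
          \<le> ennreal \<beta> * indicator {0..t} u + ennreal ((2 * \<beta> + 3) * x u) * indicator {0..t} u"
        by (cases "u \<in> {0..t}") auto
    qed
    also have "\<dots> = ennreal (\<beta> * t) + (\<integral>\<^sup>+u\<in>{0..t}. ennreal ((2 * \<beta> + 3) * x u) \<partial>lborel)"
      using t \<beta> by (subst nn_integral_add) (auto simp: nn_integral_cmult_indicator ennreal_mult)
    also have "\<dots> \<le> ennreal (\<beta> * T) + (\<integral>\<^sup>+u\<in>{0..t}. ennreal ((2 * \<beta> + 3) * x u) \<partial>lborel)"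
      using t \<beta> by (intro add_right_mono ennreal_leI mult_left_mono) auto
    finally show ?thesis .
  qed
  then have "x T \<le> 2 * (\<beta> * T) * exp (2 * (2 * \<beta> + 3) * (T - 0))"
    using T \<beta> x_le x_nonneg by (intro gronwall_nn_integral[where B="(real n)\<^sup>2"]) auto
  then show ?thesis
    by (simp only: x_def)
qed

lemma integrable_square: "integrable M (\<lambda>\<omega>. (N T \<omega>)\<^sup>2)"
proof (cases "0 \<le> T")
  case True
  let ?B = "2 * (\<beta> * T) * exp (2 * (2 * \<beta> + 3) * (T - 0))"
  let ?f = "\<lambda>n \<omega>. ennreal ((real (min (count_upto P T \<omega>) n))\<^sup>2)"
  \<comment> \<open>Truncation at the count itself changes nothing, so the supremum dominates the
    full square. Monotone convergence then carries over the bound, which is uniform in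
    \<open>n\<close>.\<close>
  have "(\<integral>\<^sup>+\<omega>. ennreal ((N T \<omega>)\<^sup>2) \<partial>M) \<le> (\<integral>\<^sup>+\<omega>. (SUP n. ?f n \<omega>) \<partial>M)"
    by (intro nn_integral_mono SUP_upper2[where i="count_upto P T _"]) auto
  also have "\<dots> = (SUP n. (\<integral>\<^sup>+\<omega>. ?f n \<omega> \<partial>M))"
    by (intro nn_integral_monotone_convergence_SUP)
       (auto simp: incseq_def le_fun_def intro!: ennreal_leI power_mono)
  also have "\<dots> \<le> ennreal ?B"
  proof (intro SUP_least)
    fix n
    have "integrable M (\<lambda>\<omega>. (real (min (count_upto P T \<omega>) n))\<^sup>2)"
      by (rule integrable_const_bound[where B="(real n)\<^sup>2"]) (auto intro!: power_mono)
    then have "(\<integral>\<^sup>+\<omega>. ?f n \<omega> \<partial>M) = ennreal (expectation (\<lambda>\<omega>. (real (min (count_upto P T \<omega>) n))\<^sup>2))"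
      by (intro nn_integral_eq_integral) auto
    then show "(\<integral>\<^sup>+\<omega>. ?f n \<omega> \<partial>M) \<le> ennreal ?B"
      using expectation_truncated_square_le[OF True, of n] by (simp only: ennreal_leI)
  qed
  also have "\<dots> < \<infinity>"
    by simp
  finally show ?thesis
    by (intro integrableI_nonneg) auto
next
  case False
  then show ?thesis
    by (simp add: count_upto_nonpos)
qed

lemma integrable_count_upto_mult: "integrable M (\<lambda>\<omega>. N s \<omega> * N t \<omega>)"
proof (rule Bochner_Integration.integrable_bound)
  show "integrable M (\<lambda>\<omega>. (N s \<omega>)\<^sup>2 + (N t \<omega>)\<^sup>2)"
    by (intro Bochner_Integration.integrable_add integrable_square)
  have "x * y \<le> x\<^sup>2 + y\<^sup>2" if "0 \<le> x" "0 \<le> y" for x y :: real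
    using sum_squares_bound[of x y] mult_nonneg_nonneg[OF that] by linarith
  then show "AE \<omega> in M. norm (N s \<omega> * N t \<omega>) \<le> norm ((N s \<omega>)\<^sup>2 + (N t \<omega>)\<^sup>2)"
    by auto
qed measurable

lemma integrable_count_upto: "integrable M (N t)"
  by (rule square_integrable_imp_integrable[OF _ integrable_square]) measurable

section \<open>Explicit first, second and mixed moments\<close>

text \<open>With a nonnegative weight the expectation is nondecreasing in time, and monotone
  functions are Borel.\<close>

lemma measurable_expectation_mult_count_upto:
  assumes "\<And>\<omega>. \<omega> \<in> space M \<Longrightarrow> 0 \<le> X \<omega>" and "\<And>u. integrable M (\<lambda>\<omega>. X \<omega> * N u \<omega>)"
  shows "(\<lambda>u. expectation (\<lambda>\<omega>. X \<omega> * N u \<omega>)) \<in> borel_measurable borel"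
proof (rule borel_measurable_mono, rule monoI)
  fix u v :: real assume "u \<le> v"
  then show "expectation (\<lambda>\<omega>. X \<omega> * N u \<omega>) \<le> expectation (\<lambda>\<omega>. X \<omega> * N v \<omega>)"
    using assms count_upto_mono[where P=P, OF finite_points[OF spp]]
    by (intro integral_mono mult_left_mono) auto
qed

text \<open>With \<open>g = h = 1\<close> the mean \<open>m\<close> satisfies
  \<open>m' = \<beta> + m / (u + 1)\<close> and \<open>m(0) = 0\<close> in integrated form.
  Equivalently, \<open>m / (u + 1)\<close> has derivative \<open>\<beta> / (u + 1)\<close>, hence
  the logarithm.\<close>

lemma expectation_count_upto:
  assumes "0 \<le> t"
  shows "expectation (N t) = \<beta> * (t + 1) * ln (t + 1)"
proof (rule linear_integral_equation_eq_solution[where T=t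
      and x="\<lambda>t. expectation (N t)"
      and y="\<lambda>t. \<beta> * (t + 1) * ln (t + 1)"
      and a="\<lambda>u. \<beta>" and b="\<lambda>u. 1 / (u + 1)" and s=0 and c=1])
  show "(\<lambda>u. expectation (N u)) \<in> borel_measurable borel"
    using measurable_expectation_mult_count_upto[of "\<lambda>_. 1"] integrable_count_upto by simp
  fix v assume v: "v \<in> {0..t}"
  have "integrable M (\<lambda>\<omega>. \<beta> + N u \<omega> / (u + 1))" for u
    using integrable_count_upto by (intro Bochner_Integration.integrable_add integrable_divide) auto
  moreover have "expectation (\<lambda>\<omega>. \<beta> + N u \<omega> / (u + 1)) = \<beta> + 1 / (u + 1) * expectation (N u)" for u
    using integrable_count_upto by (simp add: prob_space)
  ultimately show "ennreal (expectation (N v)) = ennreal (\<beta> * (0 + 1) * ln (0 + 1))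
      + (\<integral>\<^sup>+u\<in>{0..v}. ennreal (\<beta> + 1 / (u + 1) * expectation (N u)) \<partial>lborel)"
    using expectation_sum_count_upto[of "\<lambda>_. 1" "\<lambda>_. 1" 0 v] v integrable_count_upto
    by (simp add: count_upto_nonpos prob_space)
  show "((\<lambda>t. \<beta> * (t + 1) * ln (t + 1)) has_real_derivative \<beta> + 1 / (v + 1) * (\<beta> * (v + 1) * ln (v + 1))) (at v)"
    using v by (auto intro!: derivative_eq_intros)
qed (use assms \<beta> in \<open>auto intro!: integral_nonneg_AE simp: field_simps\<close>)

text \<open>The second summand is the squared mean. The first is the variance \<open>V\<close>, the
  solution of \<open>V' = \<beta> + \<beta> ln (u + 1) + 2 V / (u + 1)\<close> with
  \<open>V(0) = 0\<close>. The coefficient \<open>a\<close> below collects the terms of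
  \<open>E (2 N + 1) (\<beta> + N / (u + 1))\<close> that are constant or linear in
  \<open>N\<close>, with the known mean inserted.\<close>

lemma expectation_count_upto_square:
  assumes "0 \<le> t"
  shows "expectation (\<lambda>\<omega>. (N t \<omega>)\<^sup>2)
    = \<beta> * (t + 1) * (2 * t - ln (t + 1)) + (\<beta> * (t + 1) * ln (t + 1))\<^sup>2"
proof (rule linear_integral_equation_eq_solution[where T=t
      and x="\<lambda>t. expectation (\<lambda>\<omega>. (N t \<omega>)\<^sup>2)"
      and y="\<lambda>t. \<beta> * (t + 1) * (2 * t - ln (t + 1)) + (\<beta> * (t + 1) * ln (t + 1))\<^sup>2"
      and a="\<lambda>u. \<beta> + (2 * \<beta> + 1 / (u + 1)) * (\<beta> * (u + 1) * ln (u + 1))"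
      and b="\<lambda>u. 2 / (u + 1)" and s=0 and c=2])
  show "(\<lambda>t. expectation (\<lambda>\<omega>. (N t \<omega>)\<^sup>2)) \<in> borel_measurable borel"
  proof (rule borel_measurable_mono, rule monoI)
    fix u v :: real assume "u \<le> v"
    then show "expectation (\<lambda>\<omega>. (N u \<omega>)\<^sup>2) \<le> expectation (\<lambda>\<omega>. (N v \<omega>)\<^sup>2)"
      using count_upto_mono[where P=P, OF finite_points[OF spp]]
      by (intro integral_mono integrable_square power_mono) auto
  qed
  fix v assume v: "v \<in> {0..t}"
  have eq: "(2 * N u \<omega> + 1) * (\<beta> + N u \<omega> / (u + 1))
      = \<beta> + (2 * \<beta> + 1 / (u + 1)) * N u \<omega> + 2 / (u + 1) * (N u \<omega>)\<^sup>2" for u \<omega>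
    by (simp add: algebra_simps power2_eq_square add_divide_distrib)
  have "integrable M (\<lambda>\<omega>. (2 * N u \<omega> + 1) * (\<beta> + N u \<omega> / (u + 1)))" for u
    unfolding eq using integrable_count_upto integrable_square
    by (intro Bochner_Integration.integrable_add integrable_mult_right) auto
  moreover have exp_eq: "expectation (\<lambda>\<omega>. (2 * N u \<omega> + 1) * (\<beta> + N u \<omega> / (u + 1)))
      = \<beta> + (2 * \<beta> + 1 / (u + 1)) * (\<beta> * (u + 1) * ln (u + 1)) + 2 / (u + 1) * expectation (\<lambda>\<omega>. (N u \<omega>)\<^sup>2)"
    if "u \<in> {0..v}" for u
  proof -
    have "0 \<le> u"
      using that by simp
    then show ?thesis
      unfolding eq expectation_count_upto[OF \<open>0 \<le> u\<close>, symmetric]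
      using integrable_count_upto[of u] integrable_square[of u] by (simp add: prob_space)
  qed
  ultimately have "ennreal (expectation (\<lambda>\<omega>. (N v \<omega>)\<^sup>2))
      = (\<integral>\<^sup>+u\<in>{0..v}. ennreal (expectation (\<lambda>\<omega>. (2 * N u \<omega> + 1) * (\<beta> + N u \<omega> / (u + 1)))) \<partial>lborel)"
    using expectation_sum_count_upto[of "\<lambda>_. 1" "\<lambda>k. 2 * real k + 1" 0 v] v integrable_square[of v]
    by (simp add: count_upto_nonpos atLeast0LessThan sum_odd_nat)
  also have "\<dots> = (\<integral>\<^sup>+u\<in>{0..v}. ennreal (\<beta> + (2 * \<beta> + 1 / (u + 1)) * (\<beta> * (u + 1) * ln (u + 1))
        + 2 / (u + 1) * expectation (\<lambda>\<omega>. (N u \<omega>)\<^sup>2)) \<partial>lborel)"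
    using exp_eq by (intro nn_integral_cong) (auto simp: indicator_def)
  finally show "ennreal (expectation (\<lambda>\<omega>. (N v \<omega>)\<^sup>2))
      = ennreal (\<beta> * (0 + 1) * (2 * 0 - ln (0 + 1)) + (\<beta> * (0 + 1) * ln (0 + 1))\<^sup>2)
      + (\<integral>\<^sup>+u\<in>{0..v}. ennreal (\<beta> + (2 * \<beta> + 1 / (u + 1)) * (\<beta> * (u + 1) * ln (u + 1))
        + 2 / (u + 1) * expectation (\<lambda>\<omega>. (N u \<omega>)\<^sup>2)) \<partial>lborel)"
    by simp
  \<comment> \<open>In terms of \<open>w\<close> every denominator is a single positive
    variable.\<close>
  define w where "w = v + 1"
  have w: "0 < w" "v = w - 1"
    using v by (auto simp: w_def)
  show "((\<lambda>t. \<beta> * (t + 1) * (2 * t - ln (t + 1)) + (\<beta> * (t + 1) * ln (t + 1))\<^sup>2) has_real_derivative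
      \<beta> + (2 * \<beta> + 1 / (v + 1)) * (\<beta> * (v + 1) * ln (v + 1))
        + 2 / (v + 1) * (\<beta> * (v + 1) * (2 * v - ln (v + 1)) + (\<beta> * (v + 1) * ln (v + 1))\<^sup>2)) (at v)"
    unfolding w(2) using w(1)
    by (auto intro!: derivative_eq_intros simp: divide_simps power2_eq_square) (simp add: algebra_simps)?
next
  fix v assume v: "v \<in> {0..t}"
  \<comment> \<open>This makes the variance summand, and so the candidate solution, nonnegative, as
    the uniqueness lemma requires.\<close>
  then have "ln (v + 1) \<le> 2 * v"
    using ln_add_one_self_le_self[of v] by (simp add: add.commute)
  then show "0 \<le> \<beta> * (v + 1) * (2 * v - ln (v + 1)) + (\<beta> * (v + 1) * ln (v + 1))\<^sup>2"
    using v \<beta> by auto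
qed (use assms \<beta> in \<open>auto intro!: integral_nonneg_AE simp: field_simps\<close>)

text \<open>For fixed \<open>s\<close> the choice \<open>g(k) = k\<close>, \<open>h = 1\<close>
  gives an equation started at time \<open>s\<close>, with the second moment at \<open>s\<close> as
  initial value. The covariance part \<open>c\<close> then satisfies
  \<open>c' = c / (t + 1)\<close>, so it is the variance at \<open>s\<close> multiplied by
  \<open>(t + 1) / (s + 1)\<close>.\<close>

lemma expectation_count_upto_mult:
  assumes s: "0 \<le> s" and st: "s \<le> t"
  shows "expectation (\<lambda>\<omega>. N s \<omega> * N t \<omega>)
    = \<beta> * (t + 1) * (2 * s - ln (s + 1)) + (\<beta> * (s + 1) * ln (s + 1)) * (\<beta> * (t + 1) * ln (t + 1))"
proof (rule linear_integral_equation_eq_solution[where T=t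
      and x="\<lambda>t. expectation (\<lambda>\<omega>. N s \<omega> * N t \<omega>)"
      and y="\<lambda>t. \<beta> * (t + 1) * (2 * s - ln (s + 1)) + (\<beta> * (s + 1) * ln (s + 1)) * (\<beta> * (t + 1) * ln (t + 1))"
      and a="\<lambda>u. \<beta> * (\<beta> * (s + 1) * ln (s + 1))"
      and b="\<lambda>u. 1 / (u + 1)" and s=s and c=1])
  show "(\<lambda>t. expectation (\<lambda>\<omega>. N s \<omega> * N t \<omega>)) \<in> borel_measurable borel"
    by (intro measurable_expectation_mult_count_upto integrable_count_upto_mult) auto
  fix v assume v: "v \<in> {s..t}"
  have eq: "N s \<omega> * (\<beta> + N u \<omega> / (u + 1)) = \<beta> * N s \<omega> + 1 / (u + 1) * (N s \<omega> * N u \<omega>)" for u \<omega>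
    by (simp add: algebra_simps)
  \<comment> \<open>The number of summands is a difference of natural numbers. Monotonicity of the
    count makes it agree with the real difference.\<close>
  have sum_eq: "N s \<omega> * (\<Sum>k\<in>{count_upto P s \<omega>..<count_upto P v \<omega>}. 1) = N s \<omega> * N v \<omega> - (N s \<omega>)\<^sup>2"
    if "\<omega> \<in> space M" for \<omega>
    using count_upto_mono[where P=P, OF finite_points[OF spp that], of s v] v
    by (simp add: of_nat_diff algebra_simps power2_eq_square)
  have int_sum: "integrable M (\<lambda>\<omega>. N s \<omega> * (\<Sum>k\<in>{count_upto P s \<omega>..<count_upto P v \<omega>}. 1))"
    using integrable_count_upto_mult integrable_square
    by (subst Bochner_Integration.integrable_cong[OF refl sum_eq]) auto
  have exp_sum: "expectation (\<lambda>\<omega>. N s \<omega> * (\<Sum>k\<in>{count_upto P s \<omega>..<count_upto P v \<omega>}. 1))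
      = expectation (\<lambda>\<omega>. N s \<omega> * N v \<omega>) - expectation (\<lambda>\<omega>. (N s \<omega>)\<^sup>2)"
    using integrable_count_upto_mult integrable_square
    by (subst Bochner_Integration.integral_cong[OF refl sum_eq]) auto
  \<comment> \<open>Nonnegativity of this difference of moments allows the mixed moment to be split
    into a sum of two extended nonnegative numbers below.\<close>
  have exp_nonneg: "0 \<le> expectation (\<lambda>\<omega>. N s \<omega> * (\<Sum>k\<in>{count_upto P s \<omega>..<count_upto P v \<omega>}. 1))"
    by (intro integral_nonneg_AE) auto
  have "integrable M (\<lambda>\<omega>. N s \<omega> * 1 * (\<beta> + N u \<omega> / (u + 1)))" for u
    unfolding mult_1_right eq using integrable_count_upto integrable_count_upto_mult
    by (intro Bochner_Integration.integrable_add integrable_mult_right) auto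
  moreover have "expectation (\<lambda>\<omega>. N s \<omega> * 1 * (\<beta> + N u \<omega> / (u + 1)))
      = \<beta> * (\<beta> * (s + 1) * ln (s + 1)) + 1 / (u + 1) * expectation (\<lambda>\<omega>. N s \<omega> * N u \<omega>)" for u
    unfolding mult_1_right eq expectation_count_upto[OF s, symmetric]
    using integrable_count_upto[of s] integrable_count_upto_mult[of s u] by simp
  ultimately have "ennreal (expectation (\<lambda>\<omega>. N s \<omega> * N v \<omega>) - expectation (\<lambda>\<omega>. (N s \<omega>)\<^sup>2))
      = (\<integral>\<^sup>+u\<in>{s..v}. ennreal (\<beta> * (\<beta> * (s + 1) * ln (s + 1))
          + 1 / (u + 1) * expectation (\<lambda>\<omega>. N s \<omega> * N u \<omega>)) \<partial>lborel)"
    using expectation_sum_count_upto[of real "\<lambda>_. 1" s v] s v int_sum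
    unfolding exp_sum by simp
  moreover have "ennreal (expectation (\<lambda>\<omega>. N s \<omega> * N v \<omega>)) = ennreal (expectation (\<lambda>\<omega>. (N s \<omega>)\<^sup>2))
      + ennreal (expectation (\<lambda>\<omega>. N s \<omega> * N v \<omega>) - expectation (\<lambda>\<omega>. (N s \<omega>)\<^sup>2))"
    using exp_nonneg unfolding exp_sum
    by (subst ennreal_plus[symmetric]) (auto intro!: integral_nonneg_AE)
  ultimately show "ennreal (expectation (\<lambda>\<omega>. N s \<omega> * N v \<omega>))
      = ennreal (\<beta> * (s + 1) * (2 * s - ln (s + 1)) + (\<beta> * (s + 1) * ln (s + 1)) * (\<beta> * (s + 1) * ln (s + 1)))
      + (\<integral>\<^sup>+u\<in>{s..v}. ennreal (\<beta> * (\<beta> * (s + 1) * ln (s + 1))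
          + 1 / (u + 1) * expectation (\<lambda>\<omega>. N s \<omega> * N u \<omega>)) \<partial>lborel)"
    unfolding expectation_count_upto_square[OF s] by (simp add: power2_eq_square)
  define w where "w = v + 1"
  have w: "0 < w" "v = w - 1"
    using v s by (auto simp: w_def)
  show "((\<lambda>t. \<beta> * (t + 1) * (2 * s - ln (s + 1)) + (\<beta> * (s + 1) * ln (s + 1)) * (\<beta> * (t + 1) * ln (t + 1)))
      has_real_derivative \<beta> * (\<beta> * (s + 1) * ln (s + 1)) + 1 / (v + 1)
        * (\<beta> * (v + 1) * (2 * s - ln (s + 1)) + (\<beta> * (s + 1) * ln (s + 1)) * (\<beta> * (v + 1) * ln (v + 1)))) (at v)"
    unfolding w(2) using w(1)
    by (auto intro!: derivative_eq_intros simp: divide_simps) (simp add: algebra_simps)?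
next
  fix v assume v: "v \<in> {s..t}"
  have "ln (s + 1) \<le> 2 * s"
    using ln_add_one_self_le_self[OF s] s by (simp add: add.commute)
  then show "0 \<le> \<beta> * (v + 1) * (2 * s - ln (s + 1)) + (\<beta> * (s + 1) * ln (s + 1)) * (\<beta> * (v + 1) * ln (v + 1))"
    using s v \<beta> by (intro add_nonneg_nonneg mult_nonneg_nonneg) auto
qed (use assms \<beta> in \<open>auto intro!: integral_nonneg_AE simp: field_simps\<close>)

lemma covariance_count_upto:
  assumes "0 \<le> s" and "s \<le> t"
  shows "covariance M (N t) (N s) = \<beta> * (t + 1) * (2 * s - ln (s + 1))"
proof -
  have "covariance M (N t) (N s) = expectation (\<lambda>\<omega>. N s \<omega> * N t \<omega> - expectation (N s) * N t \<omega>
      - expectation (N t) * N s \<omega> + expectation (N s) * expectation (N t))"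
    unfolding covariance_def by (intro Bochner_Integration.integral_cong) (auto simp: algebra_simps)
  also have "\<dots> = expectation (\<lambda>\<omega>. N s \<omega> * N t \<omega>) - expectation (N s) * expectation (N t)"
    using integrable_count_upto[of s] integrable_count_upto[of t] integrable_count_upto_mult[of s t]
    by (simp add: prob_space)
  \<comment> \<open>The second summand of the mixed moment is exactly the product of the means and
    cancels.\<close>
  finally show ?thesis
    using assms by (simp add: expectation_count_upto_mult expectation_count_upto)
qed

end

text \<open>Square integrability is asserted along with the formula because a Bochner integral of a
  non-integrable function is 0 by convention; with it, the covariance is a genuine one.\<close>

theorem proposition20:
  fixes M :: "'a measure" and P :: "'a \<Rightarrow> real set" and \<beta> s t :: real
  assumes "prob_space M"
    and "\<beta> > 0"
    and "simple_point_process M P"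
    and "stochastic_intensity M P (natural_filtration M P)
           (\<lambda>u \<omega>. \<beta> + real (count_before P u \<omega>) / (u + 1))"
    and "0 \<le> s" and "s < t"
  shows "integrable M (\<lambda>\<omega>. (real (count_upto P s \<omega>))\<^sup>2)
    \<and> integrable M (\<lambda>\<omega>. (real (count_upto P t \<omega>))\<^sup>2)
    \<and> covariance M (\<lambda>\<omega>. real (count_upto P t \<omega>)) (\<lambda>\<omega>. real (count_upto P s \<omega>))
        = - \<beta> * (t + 1) * ln (s + 1) + 2 * \<beta> * s * (t + 1)"
  using integrable_square[OF assms(1-4)] covariance_count_upto[OF assms(1-4), of s t] assms(5,6)
  by (simp add: algebra_simps)

end
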